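(* Let $k \in \mathbb{N}$ with $k \geq 2$ and let $m = 3 \cdot 2^{k-2}$. Then there exists a perfect covering cycle $\overline{S_1S_2} \cup \overline{S_2S_3} \cup \dots \cup \overline{S_{m}S_{1}}$ for $H(2,k) = \{0,1\}^k \subset \mathbb{R}^k$, with $m$ links, having exactly $m = 3 \cdot 2^{k-2}$ distinct Steiner points $S_1, \dots, S_m$ (i.e. these $m$ points are pairwise distinct) and such that $S_{m+1} = S_1$.
   Context: A polygonal chain with $m$ links (i.e. of link-length $m$) in $\mathbb{R}^k$ is given by a sequence of $m+1$ vertices $S_1, S_2, \dots, S_{m+1} \in \mathbb{R}^k$ (arbitrary points, not necessarily in $\{0,1\}^k$ or in $[0,1]^k$; these vertices, i.e. turning points, are the Steiner points of the chain); its links are the closed line segments $\overline{S_1S_2}, \overline{S_2S_3}, \dots, \overline{S_mS_{m+1}}$, and as a point set it is $\mathcal{P}(m) = \overline{S_1S_2} \cup \overline{S_2S_3} \cup \dots \cup \overline{S_mS_{m+1}}$. Self-intersections are allowed. The chain covers a point set $X$ if $X \subset \mathcal{P}(m)$. $H(2,k) = \{0,1\}^k \subset \mathbb{R}^k$ is the set of the $2^k$ nodes of the hypercube $[0,1]^k$. A polygonal chain covering $H(2,k)$ is a covering path if no element of $H(2,k)$ belongs to more than one link of the chain (the path may be self-intersecting elsewhere). A covering cycle is a covering path that is closed, i.e. $S_1 = S_{m+1}$. A perfect covering cycle is a covering cycle such that no element of $\{S_j \mid j = 1, 2, \dots, m+1\}$ belongs to more than two links of the chain. *)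

theory Defs
  imports "HOL-Analysis.Analysis"
begin

text \<open>
  A polygonal chain with \<open>m\<close> links is given by a vertex sequence \<open>S\<close>, of which only the
  values \<open>S 1, \<dots>, S (m + 1)\<close> matter. These vertices are its Steiner points; they are
  arbitrary points of the ambient space.
\<close>

definition link :: "(nat \<Rightarrow> 'a::real_vector) \<Rightarrow> nat \<Rightarrow> 'a set"
  where "link S j = closed_segment (S j) (S (j + 1))"

definition chain_set :: "nat \<Rightarrow> (nat \<Rightarrow> 'a::real_vector) \<Rightarrow> 'a set"
  where "chain_set m S = (\<Union>j\<in>{1..m}. link S j)"

definition steiner_points :: "nat \<Rightarrow> (nat \<Rightarrow> 'a) \<Rightarrow> 'a set"
  where "steiner_points m S = {S j | j. j \<in> {1..m + 1}}"

text \<open>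
  Links are counted by their index, so a segment that is traversed twice counts twice.
  A vertex lies on both of its adjacent links; in a closed chain \<open>S 1 = S (m + 1)\<close> lies on
  the links \<open>1\<close> and \<open>m\<close>.
\<close>

definition num_links_through :: "nat \<Rightarrow> (nat \<Rightarrow> 'a::real_vector) \<Rightarrow> 'a \<Rightarrow> nat"
  where "num_links_through m S x = card {j \<in> {1..m}. x \<in> link S j}"

definition hypercube_nodes :: "(real ^ 'n) set"
  where "hypercube_nodes = {x. \<forall>i. x $ i \<in> {0, 1}}"

definition covering_path :: "nat \<Rightarrow> (nat \<Rightarrow> real ^ 'n) \<Rightarrow> bool"
  where "covering_path m S \<longleftrightarrow>
    hypercube_nodes \<subseteq> chain_set m S \<and>
    (\<forall>x\<in>hypercube_nodes. num_links_through m S x \<le> 1)"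

definition covering_cycle :: "nat \<Rightarrow> (nat \<Rightarrow> real ^ 'n) \<Rightarrow> bool"
  where "covering_cycle m S \<longleftrightarrow> covering_path m S \<and> S 1 = S (m + 1)"

definition perfect_covering_cycle :: "nat \<Rightarrow> (nat \<Rightarrow> real ^ 'n) \<Rightarrow> bool"
  where "perfect_covering_cycle m S \<longleftrightarrow>
    covering_cycle m S \<and> (\<forall>x\<in>steiner_points m S. num_links_through m S x \<le> 2)"

end

theory Submission
  imports Defs
begin

text \<open>
  Single out one coordinate \<open>c\<close> as the height. The bottom facet of the cube (height \<open>0\<close>) has
  \<open>N = 2 ^ (k - 2)\<close> main diagonals, all of which pass through the centre of that facet; their
  prolongations cover the bottom nodes, two per link. To pass from one diagonal to the next, the
  cycle climbs to an apex on the vertical axis through that centre and comes down again. Any two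
  diagonals can be joined in this way, because a diagonal spans a vertical plane with the axis:
  if a diagonal is prolonged to the right distance, the slanted link from its end to the apex
  passes through the top node above the end of the unprolonged diagonal. Thus one diagonal and
  two slanted links account for four nodes, and \<open>N\<close> rounds give \<open>3 * N\<close> links.

  The diagonals may be taken in any order. What has to be arranged is that the apices are
  distinct: the \<open>i\<close>-th one gets height \<open>i + 2\<close>, which fixes how far the two diagonals next to it
  are prolonged. All incidences are then read off from the two coordinates \<open>(a, z)\<close> of a point
  in the vertical plane over a diagonal: the lemmas \<open>on_diagonal_link\<close>, \<open>on_up_link\<close> and
  \<open>on_down_link\<close> say which links a point can lie on, and both multiplicity bounds follow
  from them.
\<close>

section \<open>Vertical planes over the diagonals of the bottom facet\<close>

text \<open>
  The point with parameter \<open>a\<close> and height \<open>z\<close> in the plane spanned by the vertical axis and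
  the diagonal direction \<open>\<sigma>\<close>. The nodes in this plane are the points with
  \<open>a = 1 / 2\<close> or \<open>a = - 1 / 2\<close> and \<open>z = 0\<close> or \<open>z = 1\<close>.
\<close>

definition plane_pt :: "'n \<Rightarrow> real \<Rightarrow> real ^ 'n \<Rightarrow> real \<Rightarrow> real ^ 'n"
  where "plane_pt c a \<sigma> z = (\<chi> l. if l = c then z else 1 / 2 + a * \<sigma> $ l)"

text \<open>
  Requiring the entry \<open>1\<close> at \<open>d\<close> selects one of the two opposite directions of each diagonal.
\<close>

definition diagonal_dirs :: "'n \<Rightarrow> 'n \<Rightarrow> (real ^ 'n) set"
  where "diagonal_dirs c d =
    {\<sigma>. \<sigma> $ c = 0 \<and> \<sigma> $ d = 1 \<and> (\<forall>l. l \<noteq> c \<longrightarrow> \<sigma> $ l = 1 \<or> \<sigma> $ l = - 1)}"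

lemma card_diagonal_dirs:
  fixes c d :: "'n::finite"
  assumes "c \<noteq> d"
  shows "card (diagonal_dirs c d) = 2 ^ (CARD('n) - 2)"
proof -
  let ?f = "\<lambda>X. (\<chi> l. if l = c then 0 else if l = d \<or> l \<in> X then 1 else - 1) :: real ^ 'n"
  let ?P = "Pow (UNIV - {c, d})"
  have inj: "inj_on ?f ?P"
  proof (rule inj_onI)
    fix X Y assume XY: "X \<in> ?P" "Y \<in> ?P" and eq: "?f X = ?f Y"
    have "l \<in> X \<longleftrightarrow> l \<in> Y" for l
    proof (cases "l = c \<or> l = d")
      case True
      then show ?thesis using XY by auto
    next
      case False
      then show ?thesis using arg_cong[OF eq, of "\<lambda>v. v $ l"] by (simp split: if_splits)
    qed
    then show "X = Y" by blast
  qed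
  have image: "?f ` ?P = diagonal_dirs c d"
  proof
    show "?f ` ?P \<subseteq> diagonal_dirs c d"
    proof (rule image_subsetI)
      fix X
      show "?f X \<in> diagonal_dirs c d"
        using assms by (simp add: diagonal_dirs_def)
    qed
    show "diagonal_dirs c d \<subseteq> ?f ` ?P"
    proof
      fix \<sigma> assume "\<sigma> \<in> diagonal_dirs c d"
      then have "\<sigma> = ?f {l. l \<noteq> c \<and> l \<noteq> d \<and> \<sigma> $ l = 1}"
        by (auto simp: diagonal_dirs_def vec_eq_iff)
      then show "\<sigma> \<in> ?f ` ?P" by blast
    qed
  qed
  have "card (diagonal_dirs c d) = card ?P"
    using card_image[OF inj] unfolding image .
  also have "\<dots> = 2 ^ (CARD('n) - 2)"
    using assms by (simp add: card_Pow card_Diff_subset)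
  finally show ?thesis .
qed

text \<open>
  Doubling the horizontal offset of a node from the centre gives a sign vector. Multiplying this
  vector by its own entry at \<open>d\<close> normalises it, and the sign moves into the parameter \<open>a\<close>.
\<close>

lemma hypercube_node_cases:
  fixes x :: "real ^ 'n::finite"
  assumes "x \<in> hypercube_nodes" and "c \<noteq> d"
  obtains \<sigma> a z where "\<sigma> \<in> diagonal_dirs c d" "x = plane_pt c a \<sigma> z"
    "a = 1 / 2 \<or> a = - 1 / 2" "z = 0 \<or> z = 1"
proof
  let ?a = "x $ d - 1 / 2"
  let ?\<sigma> = "(\<chi> l. if l = c then 0 else (2 * x $ d - 1) * (2 * x $ l - 1)) :: real ^ 'n"
  have x: "x $ l = 0 \<or> x $ l = 1" for l
    using assms(1) by (auto simp: hypercube_nodes_def)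
  show "?\<sigma> \<in> diagonal_dirs c d"
  proof -
    have "?\<sigma> $ l = 1 \<or> ?\<sigma> $ l = - 1" if "l \<noteq> c" for l
      using x[of d] x[of l] that by auto
    moreover have "?\<sigma> $ d = 1" using assms(2) x[of d] by auto
    ultimately show ?thesis by (simp add: diagonal_dirs_def)
  qed
  show "x = plane_pt c ?a ?\<sigma> (x $ c)"
    using x[of d] by (auto simp: plane_pt_def vec_eq_iff field_simps)
  show "?a = 1 / 2 \<or> ?a = - 1 / 2" using x[of d] by auto
  show "x $ c = 0 \<or> x $ c = 1" using x .
qed

lemma plane_pt_axis: "plane_pt c 0 \<sigma> z = plane_pt c 0 \<tau> z"
  by (simp add: plane_pt_def cong: if_cong)

text \<open>
  Planes over distinct diagonals meet only in the axis, and within a plane the coordinates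
  \<open>(a, z)\<close> are unique. This is what reduces all incidence questions to planar ones.
\<close>

lemma plane_pt_eqD:
  assumes "plane_pt c a \<sigma> z = plane_pt c b \<tau> y" and "c \<noteq> d"
    and "\<sigma> \<in> diagonal_dirs c d" "\<tau> \<in> diagonal_dirs c d"
  shows "a = b" and "z = y" and "a \<noteq> 0 \<Longrightarrow> \<sigma> = \<tau>"
proof -
  \<comment> \<open>the coordinates \<open>c\<close> and \<open>d\<close> show \<open>z\<close> and \<open>1 / 2 + a\<close>\<close>
  have eq: "(if l = c then z else 1 / 2 + a * \<sigma> $ l) = (if l = c then y else 1 / 2 + b * \<tau> $ l)"
    for l
    using arg_cong[OF assms(1), of "\<lambda>v. v $ l"] by (simp add: plane_pt_def)
  show "z = y" using eq[of c] by simp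
  show ab: "a = b"
    using eq[of d] assms by (auto simp: diagonal_dirs_def)
  show "\<sigma> = \<tau>" if "a \<noteq> 0"
  proof -
    have "\<sigma> $ l = \<tau> $ l" for l
      using eq[of l] ab that assms(3,4) by (cases "l = c") (auto simp: diagonal_dirs_def)
    then show ?thesis by (simp add: vec_eq_iff)
  qed
qed

lemma in_closed_segment_plane_pt:
  "x \<in> closed_segment (plane_pt c a \<sigma> z) (plane_pt c b \<sigma> y) \<longleftrightarrow>
    (\<exists>u. 0 \<le> u \<and> u \<le> 1 \<and> x = plane_pt c ((1 - u) * a + u * b) \<sigma> ((1 - u) * z + u * y))"
proof -
  have "(1 - u) *\<^sub>R plane_pt c a \<sigma> z + u *\<^sub>R plane_pt c b \<sigma> y
      = plane_pt c ((1 - u) * a + u * b) \<sigma> ((1 - u) * z + u * y)" for u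
    by (simp add: plane_pt_def vec_eq_iff algebra_simps)
  then show ?thesis by (simp add: in_segment)
qed

section \<open>The cycle\<close>

text \<open>
  The line through \<open>(a, z) = (reach i, 0)\<close> and the apex \<open>(0, i + 2)\<close> passes through the
  point \<open>(1 / 2, 1)\<close>; this determines \<open>reach i\<close>.
\<close>

definition reach :: "nat \<Rightarrow> real"
  where "reach i = (real i + 2) / (2 * (real i + 1))"

lemma reach_gt_half: "reach i > 1 / 2"
  by (simp add: reach_def field_simps)

lemma reach_at_height_1: "(1 - 1 / (real i + 2)) * reach i = 1 / 2"
proof -
  have "1 - 1 / (real i + 2) = (real i + 1) / (real i + 2)"
    by (simp add: field_simps)
  moreover have "real i + 1 \<noteq> 0" "real i + 2 \<noteq> 0" by linarith+
  ultimately show ?thesis by (simp add: reach_def)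
qed

locale fan =
  fixes c d :: "'n::finite" and N :: nat and g :: "nat \<Rightarrow> real ^ 'n"
  assumes cd: "c \<noteq> d" and N: "N > 0" and g: "bij_betw g {..<N} (diagonal_dirs c d)"
begin

definition pred :: "nat \<Rightarrow> nat"
  where "pred i = (if i = 0 then N - 1 else i - 1)"

definition dir :: "nat \<Rightarrow> real ^ 'n"
  where "dir i = g (if i = N then 0 else i)"

text \<open>
  Round \<open>i < N\<close> consists of the vertices \<open>3 * i + 1\<close> and \<open>3 * i + 2\<close>, the ends of the
  prolonged diagonal, and \<open>3 * i + 3\<close>, the apex. The vertex \<open>3 * N + 1\<close> that closes the cycle
  belongs to round \<open>N\<close>, whence the wrap-around in \<open>dir\<close>.
\<close>

definition vertex :: "nat \<Rightarrow> real ^ 'n"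
  where "vertex j = (let i = (j - 1) div 3; r = (j - 1) mod 3 in
    if r = 0 then plane_pt c (- reach (pred i)) (dir i) 0
    else if r = 1 then plane_pt c (reach i) (dir i) 0
    else plane_pt c 0 (dir i) (real i + 2))"

lemma vertex_simps:
  "vertex (3 * i + 1) = plane_pt c (- reach (pred i)) (dir i) 0"
  "vertex (3 * i + 2) = plane_pt c (reach i) (dir i) 0"
  "vertex (3 * i + 3) = plane_pt c 0 (dir i) (real i + 2)"
proof -
  have "(3 * i + 2 - 1) div 3 = i" "(3 * i + 2 - 1) mod 3 = 1"
    "(3 * i + 3 - 1) div 3 = i" "(3 * i + 3 - 1) mod 3 = 2"
    by (linarith, simp add: mod_Suc, linarith, simp add: mod_Suc)
  then show "vertex (3 * i + 2) = plane_pt c (reach i) (dir i) 0"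
    "vertex (3 * i + 3) = plane_pt c 0 (dir i) (real i + 2)"
    unfolding vertex_def Let_def by simp_all
qed (simp add: vertex_def)

lemma index_cases:
  assumes "j \<in> {1..3 * N}"
  obtains i where "i < N" "j = 3 * i + 1 \<or> j = 3 * i + 2 \<or> j = 3 * i + 3"
proof -
  have "(j - 1) div 3 < N" "j = 3 * ((j - 1) div 3) + 1 \<or> j = 3 * ((j - 1) div 3) + 2
    \<or> j = 3 * ((j - 1) div 3) + 3"
    using assms by auto
  then show ?thesis using that by blast
qed

lemma dir_in: "i \<le> N \<Longrightarrow> dir i \<in> diagonal_dirs c d"
  using g N by (auto simp: dir_def bij_betw_def)

lemma dir_inj: "i < N \<Longrightarrow> j < N \<Longrightarrow> dir i = dir j \<Longrightarrow> i = j"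
  using g by (auto simp: dir_def bij_betw_def inj_on_def)

lemma dir_Suc_inj: "i < N \<Longrightarrow> j < N \<Longrightarrow> dir (i + 1) = dir j \<Longrightarrow> i = pred j"
  using dir_inj[of "i + 1" j] dir_inj[of 0 j] N
  by (cases "i + 1 = N") (auto simp: dir_def pred_def)

lemma dir_surj:
  assumes "\<sigma> \<in> diagonal_dirs c d"
  obtains i where "i < N" "\<sigma> = dir i"
proof -
  obtain i where "i < N" "\<sigma> = g i"
    using assms g by (auto simp: bij_betw_def)
  then show ?thesis using that[of i] by (simp add: dir_def)
qed

lemma pred_less: "i < N \<Longrightarrow> pred i < N"
  by (auto simp: pred_def)

lemma dir_Suc_pred: "i < N \<Longrightarrow> dir (pred i + 1) = dir i"
  using N by (auto simp: dir_def pred_def)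

lemma vertex_closed: "vertex (3 * N + 1) = vertex 1"
  using vertex_simps(1)[of N] vertex_simps(1)[of 0] N by (simp add: pred_def dir_def)

section \<open>Incidences\<close>

lemma link_simps:
  "link vertex (3 * i + 1)
    = closed_segment (plane_pt c (- reach (pred i)) (dir i) 0) (plane_pt c (reach i) (dir i) 0)"
  "link vertex (3 * i + 2)
    = closed_segment (plane_pt c (reach i) (dir i) 0) (plane_pt c 0 (dir i) (real i + 2))"
  "link vertex (3 * i + 3)
    = closed_segment (plane_pt c 0 (dir (i + 1)) (real i + 2))
        (plane_pt c (- reach i) (dir (i + 1)) 0)"
proof -
  show "link vertex (3 * i + 1)
    = closed_segment (plane_pt c (- reach (pred i)) (dir i) 0) (plane_pt c (reach i) (dir i) 0)"
    using vertex_simps(1,2)[of i] by (simp add: link_def)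
  have nxt: "3 * i + 2 + 1 = 3 * i + 3" "3 * i + 3 + 1 = 3 * (i + 1) + 1" by simp_all
  show "link vertex (3 * i + 2)
    = closed_segment (plane_pt c (reach i) (dir i) 0) (plane_pt c 0 (dir i) (real i + 2))"
    unfolding link_def nxt vertex_simps ..
  \<comment> \<open>the apex lies in both planes, so it may be rewritten to the direction of the next round\<close>
  have "pred (i + 1) = i" by (simp add: pred_def)
  then show "link vertex (3 * i + 3)
    = closed_segment (plane_pt c 0 (dir (i + 1)) (real i + 2))
        (plane_pt c (- reach i) (dir (i + 1)) 0)"
    unfolding link_def nxt vertex_simps plane_pt_axis[of c "dir i" _ "dir (i + 1)"] by simp
qed

text \<open>
  In each of the next three lemmas the equation for \<open>z\<close> is that of the line carrying the link in
  its plane. A point off the axis (\<open>a \<noteq> 0\<close>) determines the plane, hence the round of the link.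
\<close>

lemma on_diagonal_link:
  assumes "plane_pt c a (dir l) z \<in> link vertex (3 * i + 1)" and "l < N" "i < N"
  shows "z = 0" and "a \<noteq> 0 \<Longrightarrow> i = l"
proof -
  obtain u where u: "plane_pt c a (dir l) z =
      plane_pt c ((1 - u) * (- reach (pred i)) + u * reach i) (dir i) ((1 - u) * 0 + u * 0)"
    using assms(1) unfolding link_simps in_closed_segment_plane_pt by blast
  note * = plane_pt_eqD[OF u cd dir_in dir_in]
  show "z = 0" using *(2) assms by simp
  show "i = l" if "a \<noteq> 0" using *(3) that assms dir_inj by simp
qed

lemma on_up_link:
  assumes "plane_pt c a (dir l) z \<in> link vertex (3 * i + 2)" and "l < N" "i < N"
  shows "a \<ge> 0" and "z = real i + 2 - 2 * (real i + 1) * a" and "a \<noteq> 0 \<Longrightarrow> i = l"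
proof -
  obtain u where u: "0 \<le> u" "u \<le> 1" and eq: "plane_pt c a (dir l) z =
      plane_pt c ((1 - u) * reach i + u * 0) (dir i) ((1 - u) * 0 + u * (real i + 2))"
    using assms(1) unfolding link_simps in_closed_segment_plane_pt by blast
  note * = plane_pt_eqD[OF eq cd dir_in dir_in]
  have a: "a = (1 - u) * reach i" and z: "z = u * (real i + 2)" using *(1,2) assms by simp_all
  show "a \<ge> 0" using a u reach_gt_half[of i] by simp
  show "z = real i + 2 - 2 * (real i + 1) * a"
    unfolding a z reach_def by (simp add: field_simps)
  show "i = l" if "a \<noteq> 0" using *(3) that assms dir_inj by simp
qed

lemma on_down_link:
  assumes "plane_pt c a (dir l) z \<in> link vertex (3 * i + 3)" and "l < N" "i < N"
  shows "a \<le> 0" and "z = real i + 2 + 2 * (real i + 1) * a" and "a \<noteq> 0 \<Longrightarrow> i = pred l"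
proof -
  obtain u where u: "0 \<le> u" "u \<le> 1" and eq: "plane_pt c a (dir l) z =
      plane_pt c ((1 - u) * 0 + u * (- reach i)) (dir (i + 1)) ((1 - u) * (real i + 2) + u * 0)"
    using assms(1) unfolding link_simps in_closed_segment_plane_pt by blast
  note * = plane_pt_eqD[OF eq cd dir_in dir_in]
  have a: "a = - (u * reach i)" and z: "z = (1 - u) * (real i + 2)" using *(1,2) assms by simp_all
  show "a \<le> 0" using a u reach_gt_half[of i] by simp
  show "z = real i + 2 + 2 * (real i + 1) * a"
    unfolding a z reach_def by (simp add: field_simps)
  show "i = pred l" if "a \<noteq> 0" using *(3) that assms dir_Suc_inj[of i l] by simp
qed

lemma node_on_chain:
  assumes "l < N" and "a = 1 / 2 \<or> a = - 1 / 2" and "z = 0 \<or> z = 1"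
  shows "plane_pt c a (dir l) z \<in> chain_set (3 * N) vertex"
proof -
  have "\<exists>j\<in>{1..3 * N}. plane_pt c a (dir l) z \<in> link vertex j"
  proof (cases "z = 0")
    case True
    let ?p = "reach (pred l)" and ?q = "reach l"
    define u where "u = (a + ?p) / (?p + ?q)"
    have pq: "?p > 1 / 2" "?q > 1 / 2" by (rule reach_gt_half)+
    then have "u * (?p + ?q) = a + ?p" by (simp add: u_def)
    then have "a = (1 - u) * (- ?p) + u * ?q" by (simp add: algebra_simps)
    moreover have "0 \<le> u" "u \<le> 1"
      using pq assms(2) by (auto simp: u_def divide_simps)
    ultimately have "plane_pt c a (dir l) z \<in> link vertex (3 * l + 1)"
      unfolding link_simps in_closed_segment_plane_pt using True
      by (intro exI[of _ u]) auto
    moreover have "3 * l + 1 \<in> {1..3 * N}" using assms(1) by auto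
    ultimately show ?thesis by blast
  next
    case False
    then have z: "z = 1" using assms by blast
    show ?thesis using assms(2)
    proof
      assume a: "a = 1 / 2"
      let ?u = "1 / (real l + 2)"
      have "a = (1 - ?u) * reach l + ?u * 0" "z = (1 - ?u) * 0 + ?u * (real l + 2)"
        unfolding a z using reach_at_height_1[of l] by (simp_all add: add_eq_0_iff)
      then have "plane_pt c a (dir l) z \<in> link vertex (3 * l + 2)"
        unfolding link_simps in_closed_segment_plane_pt
        by (intro exI[of _ ?u]) auto
      moreover have "3 * l + 2 \<in> {1..3 * N}" using assms(1) by auto
      ultimately show ?thesis by blast
    next
      assume a: "a = - 1 / 2"
      define i where "i = pred l"
      let ?u = "1 - 1 / (real i + 2)"
      have "a = (1 - ?u) * 0 + ?u * (- reach i)" "z = (1 - ?u) * (real i + 2) + ?u * 0"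
        unfolding a z using reach_at_height_1[of i] by (simp_all add: add_eq_0_iff)
      moreover have "dir (i + 1) = dir l" using assms(1) dir_Suc_pred i_def by simp
      ultimately have "plane_pt c a (dir l) z \<in> link vertex (3 * i + 3)"
        unfolding link_simps in_closed_segment_plane_pt
        by (intro exI[of _ ?u]) auto
      moreover have "3 * i + 3 \<in> {1..3 * N}" using pred_less[OF assms(1)] i_def by auto
      ultimately show ?thesis by blast
    qed
  qed
  then show ?thesis by (auto simp: chain_set_def)
qed

text \<open>
  A node is off the axis, so only the diagonal link, the up link and the down link in its plane
  come into question. The diagonal link has height \<open>0\<close>; on the other two, \<open>\<bar>a\<bar> = 1 / 2\<close> forces
  height \<open>1\<close>, and the sign of \<open>a\<close> separates them.
\<close>

lemma node_on_one_link:
  assumes "l < N" and "a = 1 / 2 \<or> a = - 1 / 2" and "z = 0 \<or> z = 1"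
  shows "num_links_through (3 * N) vertex (plane_pt c a (dir l) z) \<le> 1"
proof -
  let ?x = "plane_pt c a (dir l) z"
  let ?j = "if z = 0 then 3 * l + 1 else if a > 0 then 3 * l + 2 else 3 * pred l + 3"
  have "j = ?j" if "j \<in> {1..3 * N}" and x: "?x \<in> link vertex j" for j
  proof -
    obtain i where i: "i < N" and j: "j = 3 * i + 1 \<or> j = 3 * i + 2 \<or> j = 3 * i + 3"
      using \<open>j \<in> _\<close> by (rule index_cases)
    from j show ?thesis
    proof (elim disjE)
      assume j: "j = 3 * i + 1"
      show ?thesis using on_diagonal_link[OF x[unfolded j] assms(1) i] assms(2) j by auto
    next
      assume j: "j = 3 * i + 2"
      note up = on_up_link[OF x[unfolded j] assms(1) i]
      have a: "a = 1 / 2" using up(1) assms(2) by auto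
      have "z = 1" using up(2) unfolding a by (simp add: field_simps)
      then show ?thesis using up(3) a j by simp
    next
      assume j: "j = 3 * i + 3"
      note down = on_down_link[OF x[unfolded j] assms(1) i]
      have a: "a = - 1 / 2" using down(1) assms(2) by auto
      have "z = 1" using down(2) unfolding a by (simp add: field_simps)
      then show ?thesis using down(3) a j by simp
    qed
  qed
  then have "{j \<in> {1..3 * N}. ?x \<in> link vertex j} \<subseteq> {?j}" by blast
  then show ?thesis
    unfolding num_links_through_def using card_mono[of "{?j}"] by fastforce
qed

text \<open>
  The ends of a prolonged diagonal are off the axis, so the links through them lie in one plane
  and the sign of \<open>a\<close> excludes one of the two slanted ones. An apex is on the axis, which the
  slanted links meet only in their own apices; these are separated by their heights.
\<close>

lemma vertex_on_two_links:
  assumes "n \<in> {1..3 * N}"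
  shows "num_links_through (3 * N) vertex (vertex n) \<le> 2"
proof -
  obtain l where l: "l < N" and n: "n = 3 * l + 1 \<or> n = 3 * l + 2 \<or> n = 3 * l + 3"
    using assms by (rule index_cases)
  have pos: "reach i > 0" for i using reach_gt_half[of i] by simp
  let ?n' = "if n = 3 * l + 1 then 3 * pred l + 3 else n - 1"
  have "j \<in> {n, ?n'}" if "j \<in> {1..3 * N}" and x: "vertex n \<in> link vertex j" for j
  proof -
    obtain i where i: "i < N" and j: "j = 3 * i + 1 \<or> j = 3 * i + 2 \<or> j = 3 * i + 3"
      using \<open>j \<in> _\<close> by (rule index_cases)
    from n show ?thesis
    proof (elim disjE)
      assume n: "n = 3 * l + 1"
      note x' = x[unfolded n vertex_simps]
      from j show ?thesis
        using on_diagonal_link[OF _ l i] on_up_link[OF _ l i] on_down_link[OF _ l i]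
          x' pos[of "pred l"] n by fastforce
    next
      assume n: "n = 3 * l + 2"
      note x' = x[unfolded n vertex_simps]
      from j show ?thesis
        using on_diagonal_link[OF _ l i] on_up_link[OF _ l i] on_down_link[OF _ l i]
          x' pos[of l] n by fastforce
    next
      assume n: "n = 3 * l + 3"
      note x' = x[unfolded n vertex_simps]
      from j show ?thesis
        using on_diagonal_link(1)[OF _ l i] on_up_link(2)[OF _ l i] on_down_link(2)[OF _ l i]
          x' n by fastforce
    qed
  qed
  then have "card {j \<in> {1..3 * N}. vertex n \<in> link vertex j} \<le> card {n, ?n'}"
    by (intro card_mono) blast+
  also have "\<dots> \<le> 2" by (simp add: card_insert_if)
  finally show ?thesis unfolding num_links_through_def .
qed

lemma vertex_inj: "inj_on vertex {1..3 * N}"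
proof (rule inj_onI)
  fix m n assume mn: "m \<in> {1..3 * N}" "n \<in> {1..3 * N}" and eq: "vertex m = vertex n"
  obtain i where i: "i < N" and m: "m = 3 * i + 1 \<or> m = 3 * i + 2 \<or> m = 3 * i + 3"
    using mn(1) by (rule index_cases)
  obtain l where l: "l < N" and n: "n = 3 * l + 1 \<or> n = 3 * l + 2 \<or> n = 3 * l + 3"
    using mn(2) by (rule index_cases)
  have pos: "reach i > 0" for i using reach_gt_half[of i] by simp
  have D: "a = b \<and> z = y \<and> (a = 0 \<or> i = l)"
    if "plane_pt c a (dir i) z = plane_pt c b (dir l) y" for a b z y
    using plane_pt_eqD[OF that cd dir_in dir_in] dir_inj[OF i l] i l by auto
  show "m = n"
    using m n eq pos[of i] pos[of l] pos[of "pred i"] pos[of "pred l"]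
    by (elim disjE) (simp_all only: vertex_simps, auto dest!: D)
qed

end

theorem corollary2p4:
  fixes k m :: nat
  assumes "CARD('n::finite) = k"
    and "k \<ge> 2"
    and "m = 3 * 2 ^ (k - 2)"
  shows "\<exists>S :: nat \<Rightarrow> real ^ 'n.
    perfect_covering_cycle m S \<and>
    inj_on S {1..m} \<and>
    card (steiner_points m S) = m \<and>
    S (m + 1) = S 1"
proof -
  obtain c d :: 'n where cd: "c \<noteq> d"
    using card_le_Suc0_iff_eq[of "UNIV :: 'n set"] assms(1,2) by auto
  define N :: nat where "N = 2 ^ (k - 2)"
  have cardN: "card (diagonal_dirs c d) = N"
    using card_diagonal_dirs[OF cd] assms(1) by (simp add: N_def)
  moreover have "N > 0" by (simp add: N_def)
  ultimately obtain g where "bij_betw g {..<N} (diagonal_dirs c d)"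
    using ex_bij_betw_nat_finite[of "diagonal_dirs c d"] card_gt_0_iff[of "diagonal_dirs c d"]
    by (auto simp: atLeast0LessThan)
  then interpret fan c d N g
    using cd \<open>N > 0\<close> by unfold_locales
  have m: "m = 3 * N" using assms(3) N_def by simp
  have "x \<in> chain_set m vertex \<and> num_links_through m vertex x \<le> 1"
    if node: "x \<in> hypercube_nodes" for x :: "real ^ 'n"
  proof -
    obtain \<sigma> a z where \<sigma>: "\<sigma> \<in> diagonal_dirs c d" and x: "x = plane_pt c a \<sigma> z"
      and az: "a = 1 / 2 \<or> a = - 1 / 2" "z = 0 \<or> z = 1"
      using node cd by (rule hypercube_node_cases)
    obtain l where l: "l < N" "\<sigma> = dir l" using \<sigma> by (rule dir_surj)
    show ?thesis
      unfolding m x l(2) using node_on_chain[OF l(1) az] node_on_one_link[OF l(1) az] ..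
  qed
  then have cycle: "covering_cycle m vertex"
    using vertex_closed m by (auto simp: covering_cycle_def covering_path_def)
  have "{1..m + 1} = insert (m + 1) {1..m}" by auto
  then have steiner: "steiner_points m vertex = vertex ` {1..m}"
    using vertex_closed m N by (force simp: steiner_points_def)
  have "perfect_covering_cycle m vertex"
    using cycle vertex_on_two_links[folded m] unfolding perfect_covering_cycle_def steiner by blast
  moreover have "card (steiner_points m vertex) = m"
    using card_image[OF vertex_inj] unfolding steiner by (simp add: m)
  ultimately show ?thesis
    using vertex_inj vertex_closed unfolding m by blast
qed

end
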